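(* Let $\omega$ and $\widetilde\omega$ be two families of weights on the half-space that coincide in the bulk, i.e. $\widetilde\omega_{i,j}=\omega_{i,j}$ for all $(i,j)\in\mathcal{B}$. Let $L,\widetilde L$ be the corresponding half-space last passage times from the origin, and let $\pi(\cdot),\widetilde\pi(\cdot)$ be the corresponding geodesics from the origin. Consider two end-points $p,q\in\mathcal{B}$ such that $p\preceq q$, and assume that $\widetilde\pi(p)\cap\pi(q)\cap\mathcal{B}\neq\emptyset$. If at least one of the following conditions is satisfied: (a) $\widetilde\omega_{i,i}\le\omega_{i,i}$ for all $i\ge1$; (b) $\widetilde\omega_{i,i}\ge\omega_{i,i}$ for all $i\ge 1$ and $\widetilde\pi(p)\cap\mathcal{D}=\emptyset$; then $$L(q)-L(p)\le\widetilde L(q)-\widetilde L(p).$$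
   Context: Half-space last passage percolation: given weights $\omega_{i,j}$ on $\{(i,j)\in\mathbb{Z}^2: i\ge j\ge0\}$, put $L(a,b)=\max_{\pi:a\to b}\sum_{(i,j)\in\pi\setminus\{a\}}\omega_{i,j}$, the maximum being over up-right lattice paths in the half-space from $a$ to $b$; $L(b):=L((0,0),b)$. A path attaining the maximum is called a geodesic; $\pi(b)$ is the geodesic from $(0,0)$ to $b$. $\mathcal{B}=\{(m,n)\in\mathbb{Z}^2: 0<n<m\}$ (bulk), $\mathcal{D}=\{(m,n)\in\mathbb{Z}^2:1\le n=m\}$ (diagonal). The weights $\omega,\widetilde\omega$ may differ only on the diagonal $\{n=m\ge0\}$ and on the horizontal axis $\{n=0\le m\}$. For $p=(p_1,p_2),q=(q_1,q_2)\in\mathbb{Z}^2$, $p\preceq q$ means $p_1\le q_1$ and $p_2\ge q_2$. *)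

theory Defs
  imports Complex_Main
begin

type_synonym point = "int \<times> int"

definition half_space :: "point set" where
  "half_space = {(i, j). i \<ge> j \<and> j \<ge> 0}"

definition bulk :: "point set" where
  "bulk = {(m, n). 0 < n \<and> n < m}"

definition diagonal :: "point set" where
  "diagonal = {(m, n). 1 \<le> n \<and> n = m}"

definition southeast :: "point \<Rightarrow> point \<Rightarrow> bool" (infix "\<preceq>" 50) where
  "p \<preceq> q \<longleftrightarrow> fst p \<le> fst q \<and> snd p \<ge> snd q"

definition up_right_step :: "point \<Rightarrow> point \<Rightarrow> bool" where
  "up_right_step u v \<longleftrightarrow>
     v = (fst u + 1, snd u) \<or> v = (fst u, snd u + 1)"

text \<open>A path is the list of the lattice points it visits, in order, both end-points included.\<close>

definition paths :: "point \<Rightarrow> point \<Rightarrow> point list set" where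
  "paths a b = {\<gamma>. \<gamma> \<noteq> [] \<and> hd \<gamma> = a \<and> last \<gamma> = b \<and>
                   set \<gamma> \<subseteq> half_space \<and> successively up_right_step \<gamma>}"

text \<open>Weights are total functions on \<^typ>\<open>int\<close>, but only their values on the half-space enter.\<close>

definition path_weight :: "(int \<Rightarrow> int \<Rightarrow> real) \<Rightarrow> point \<Rightarrow> point list \<Rightarrow> real" where
  "path_weight \<omega> a \<gamma> = (\<Sum>(i, j)\<in>set \<gamma> - {a}. \<omega> i j)"

text \<open>The set of paths is always finite; it is nonempty, so that the maximum is meaningful, exactly
  when \<open>a\<close> and \<open>b\<close> lie in the half-space and \<open>b\<close> is coordinatewise at least \<open>a\<close>.\<close>

definition last_passage :: "(int \<Rightarrow> int \<Rightarrow> real) \<Rightarrow> point \<Rightarrow> point \<Rightarrow> real" where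
  "last_passage \<omega> a b = Max (path_weight \<omega> a ` paths a b)"

abbreviation last_passage_origin :: "(int \<Rightarrow> int \<Rightarrow> real) \<Rightarrow> point \<Rightarrow> real" where
  "last_passage_origin \<omega> b \<equiv> last_passage \<omega> (0, 0) b"

definition geodesic :: "(int \<Rightarrow> int \<Rightarrow> real) \<Rightarrow> point \<Rightarrow> point \<Rightarrow> point list \<Rightarrow> bool" where
  "geodesic \<omega> a b \<gamma> \<longleftrightarrow> \<gamma> \<in> paths a b \<and> path_weight \<omega> a \<gamma> = last_passage \<omega> a b"

text \<open>Geodesics need not be unique for arbitrary real weights; a family of geodesics from the origin
  is any choice of one geodesic to each point of the half-space.\<close>

definition geodesics_from_origin :: "(int \<Rightarrow> int \<Rightarrow> real) \<Rightarrow> (point \<Rightarrow> point list) \<Rightarrow> bool" where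
  "geodesics_from_origin \<omega> \<Gamma> \<longleftrightarrow> (\<forall>b\<in>half_space. geodesic \<omega> (0, 0) b (\<Gamma> b))"

end

theory Submission
  imports Defs
begin

text \<open>
  Suppose the two geodesics share a vertex \<open>w\<close>. Exchanging their parts after \<open>w\<close> yields competitors
  for \<open>L(p)\<close> and \<open>L'(q)\<close>, and the claim follows as soon as, after \<open>w\<close>, \<open>\<omega> \<le> \<omega>'\<close> along \<open>\<pi>(q)\<close> and
  \<open>\<omega>' \<le> \<omega>\<close> along \<open>\<pi>'(p)\<close>. Under (b) the given common bulk vertex does this. Under (a) take for \<open>w\<close>
  the last common vertex: were \<open>\<pi>(q)\<close> to visit the diagonal after \<open>w\<close>, then at that moment it would
  lie northwest of \<open>\<pi>'(p)\<close>, and since \<open>p \<preceq> q\<close> the two paths would have to meet once more.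
\<close>

section \<open>Up-right paths, indexed by level\<close>

lemma path_step:
  assumes "\<gamma> \<in> paths a b" and "Suc i < length \<gamma>"
  shows "up_right_step (\<gamma> ! i) (\<gamma> ! Suc i)"
  using assms by (auto simp: paths_def successively_conv_nth)

lemma path_first:
  assumes "\<gamma> \<in> paths a b"
  shows "\<gamma> ! 0 = a" and "0 < length \<gamma>"
  using assms by (auto simp: paths_def hd_conv_nth)

lemma path_last:
  assumes "\<gamma> \<in> paths a b"
  shows "\<gamma> ! (length \<gamma> - 1) = b"
  using assms by (auto simp: paths_def last_conv_nth)

text \<open>Either kind of step raises the coordinate sum by one. Paths with a common start can
  therefore be compared index by index: a shared point has the same index in both.\<close>

lemma path_level:
  assumes "\<gamma> \<in> paths a b" and "i < length \<gamma>"
  shows "fst (\<gamma> ! i) + snd (\<gamma> ! i) = fst a + snd a + int i"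
  using assms(2)
proof (induction i)
  case 0
  then show ?case using path_first[OF assms(1)] by simp
next
  case (Suc i)
  then show ?case using path_step[OF assms(1), of i] by (auto simp: up_right_step_def)
qed

lemma path_length:
  assumes "\<gamma> \<in> paths a b"
  shows "int (length \<gamma>) = fst b + snd b - (fst a + snd a) + 1"
  using path_level[OF assms, of "length \<gamma> - 1"] path_first(2)[OF assms] path_last[OF assms]
  by simp

lemma path_mono:
  assumes "\<gamma> \<in> paths a b" and "i \<le> j" and "j < length \<gamma>"
  shows "fst (\<gamma> ! i) \<le> fst (\<gamma> ! j) \<and> snd (\<gamma> ! i) \<le> snd (\<gamma> ! j)"
  using assms(2,3)
proof (induction j rule: dec_induct)
  case base
  then show ?case by simp
next
  case (step j)
  then show ?case using path_step[OF assms(1), of j] by (auto simp: up_right_step_def)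
qed

lemma path_le_last:
  assumes "\<gamma> \<in> paths a b" and "i < length \<gamma>"
  shows "fst (\<gamma> ! i) \<le> fst b" and "snd (\<gamma> ! i) \<le> snd b"
  using path_mono[OF assms(1), of i "length \<gamma> - 1"] assms(2) path_last[OF assms(1)] by auto

lemma path_nth_inj:
  assumes "\<gamma> \<in> paths a b" and "i < length \<gamma>" and "j < length \<gamma>" and "\<gamma> ! i = \<gamma> ! j"
  shows "i = j"
  using path_level[OF assms(1,2)] path_level[OF assms(1,3)] unfolding assms(4) by linarith

lemma path_nth_half_space:
  assumes "\<gamma> \<in> paths a b" and "i < length \<gamma>"
  shows "\<gamma> ! i \<in> half_space"
  using assms(1) nth_mem[OF assms(2)] unfolding paths_def by blast

text \<open>Monotone coordinates confine a path to the rectangle spanned by its end-points, and the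
  levels fix its length. Finiteness is what makes \<open>Max\<close> in \<open>last_passage\<close>
  an upper bound.\<close>

lemma finite_paths: "finite (paths a b)"
proof -
  let ?R = "{fst a..fst b} \<times> {snd a..snd b}"
  let ?n = "nat (fst b + snd b - (fst a + snd a) + 1)"
  have "paths a b \<subseteq> {\<gamma>. set \<gamma> \<subseteq> ?R \<and> length \<gamma> = ?n}"
  proof
    fix \<gamma> assume \<gamma>: "\<gamma> \<in> paths a b"
    have "\<gamma> ! i \<in> ?R" if "i < length \<gamma>" for i
      using path_mono[OF \<gamma>, of 0 i] path_le_last[OF \<gamma> that] path_first(1)[OF \<gamma>] that
      by (auto simp: mem_Times_iff)
    then have "set \<gamma> \<subseteq> ?R"
      by (metis in_set_conv_nth subsetI)
    moreover have "length \<gamma> = ?n"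
      using path_length[OF \<gamma>] by linarith
    ultimately show "\<gamma> \<in> {\<gamma>. set \<gamma> \<subseteq> ?R \<and> length \<gamma> = ?n}" by blast
  qed
  then show ?thesis
    by (rule finite_subset) (intro finite_lists_length_eq finite_cartesian_product, auto)
qed

section \<open>Path weights as sums over indices\<close>

lemma path_weight_le_last_passage:
  assumes "\<gamma> \<in> paths a b"
  shows "path_weight \<omega> a \<gamma> \<le> last_passage \<omega> a b"
  unfolding last_passage_def using assms by (intro Max_ge) (auto simp: finite_paths)

text \<open>No point is visited twice, so the sum over points becomes a sum over indices, which can
  be cut at a meeting index. It starts at 1 because index 0 is the excluded point
  \<open>a\<close>.\<close>

lemma path_weight_nth:
  assumes "\<gamma> \<in> paths a b"
  shows "path_weight \<omega> a \<gamma> = (\<Sum>i = 1..<length \<gamma>. case_prod \<omega> (\<gamma> ! i))"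
proof -
  have "inj_on ((!) \<gamma>) {1..<length \<gamma>}"
    by (intro inj_onI) (auto intro: path_nth_inj[OF assms])
  moreover have "(!) \<gamma> ` {1..<length \<gamma>} = set \<gamma> - {a}"
  proof -
    have "(\<gamma> ! i = a) = (i = 0)" if "i < length \<gamma>" for i
      using path_nth_inj[OF assms that, of 0] path_first[OF assms] by metis
    then have "(!) \<gamma> ` {1..<length \<gamma>} = (!) \<gamma> ` {..<length \<gamma>} - {a}"
      by (fastforce simp: image_iff Suc_le_eq)
    then show ?thesis by (simp add: set_conv_nth image_Collect lessThan_def)
  qed
  ultimately have "bij_betw ((!) \<gamma>) {1..<length \<gamma>} (set \<gamma> - {a})"
    by (simp add: bij_betw_def)
  then show ?thesis
    unfolding path_weight_def by (rule sum.reindex_bij_betw[symmetric])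
qed

section \<open>Splicing at a common vertex\<close>

lemma path_splice:
  assumes "\<gamma> \<in> paths a b" and "\<delta> \<in> paths a c"
    and "i < length \<gamma>" and "i < length \<delta>" and "\<gamma> ! i = \<delta> ! i"
  shows "take (Suc i) \<gamma> @ drop (Suc i) \<delta> \<in> paths a c"
proof -
  let ?\<epsilon> = "take (Suc i) \<gamma> @ drop (Suc i) \<delta>"
  have len: "length ?\<epsilon> = length \<delta>" using assms by simp
  have nth: "?\<epsilon> ! k = (if k \<le> i then \<gamma> ! k else \<delta> ! k)" if "k < length \<delta>" for k
    using that assms by (auto simp: nth_append)
  have "?\<epsilon> \<noteq> []" using assms by auto
  moreover have "hd ?\<epsilon> = a"
    using assms(1) by (auto simp: paths_def)
  moreover have "last ?\<epsilon> = c"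
  proof -
    have "last ?\<epsilon> = ?\<epsilon> ! (length \<delta> - 1)"
      by (metis \<open>?\<epsilon> \<noteq> []\<close> len last_conv_nth)
    \<comment> \<open>If \<delta> ends at index \<open>i\<close>, the dropped part is empty and the
      last entry comes from \<gamma>; the meeting hypothesis identifies the two.\<close>
    also have "\<dots> = \<delta> ! (length \<delta> - 1)"
      using nth[of "length \<delta> - 1"] assms(4,5)
      by (cases "length \<delta> - 1 = i") auto
    finally show ?thesis using path_last[OF assms(2)] by simp
  qed
  moreover have "set ?\<epsilon> \<subseteq> half_space"
    using assms(1,2) by (auto simp: paths_def dest!: in_set_takeD in_set_dropD)
  moreover have "successively up_right_step ?\<epsilon>"
    unfolding successively_conv_nth
  proof (intro allI impI)
    fix k assume "Suc k < length ?\<epsilon>"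
    then have k: "Suc k < length \<delta>" using len by simp
    then show "up_right_step (?\<epsilon> ! k) (?\<epsilon> ! Suc k)"
      using nth[of k] nth[of "Suc k"] assms path_step[OF assms(2), of k] path_step[OF assms(1), of k]
      by (cases k i rule: linorder_cases) auto
  qed
  ultimately show ?thesis by (simp add: paths_def)
qed

lemma path_weight_splice:
  assumes "\<gamma> \<in> paths a b" and "\<delta> \<in> paths a c"
    and "i < length \<gamma>" and "i < length \<delta>" and "\<gamma> ! i = \<delta> ! i"
  shows "path_weight \<omega> a (take (Suc i) \<gamma> @ drop (Suc i) \<delta>) =
    (\<Sum>k = 1..<Suc i. case_prod \<omega> (\<gamma> ! k)) + (\<Sum>k = Suc i..<length \<delta>. case_prod \<omega> (\<delta> ! k))"
proof -
  let ?\<epsilon> = "take (Suc i) \<gamma> @ drop (Suc i) \<delta>"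
  have "path_weight \<omega> a ?\<epsilon> = (\<Sum>k = 1..<length \<delta>. case_prod \<omega> (?\<epsilon> ! k))"
  proof -
    have "length ?\<epsilon> = length \<delta>" using assms(3,4) by simp
    then show ?thesis by (simp only: path_weight_nth[OF path_splice[OF assms]])
  qed
  also have "\<dots> = (\<Sum>k = 1..<Suc i. case_prod \<omega> (?\<epsilon> ! k)) +
      (\<Sum>k = Suc i..<length \<delta>. case_prod \<omega> (?\<epsilon> ! k))"
    using assms(4) by (subst sum.atLeastLessThan_concat) simp_all
  also have "(\<Sum>k = 1..<Suc i. case_prod \<omega> (?\<epsilon> ! k)) = (\<Sum>k = 1..<Suc i. case_prod \<omega> (\<gamma> ! k))"
    using assms(3) by (intro sum.cong) (auto simp: nth_append)
  also have "(\<Sum>k = Suc i..<length \<delta>. case_prod \<omega> (?\<epsilon> ! k)) =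
      (\<Sum>k = Suc i..<length \<delta>. case_prod \<omega> (\<delta> ! k))"
    using assms(3,4) by (intro sum.cong) (auto simp: nth_append)
  finally show ?thesis .
qed

text \<open>The head of \<gamma> with the tail of \<delta> competes for \<open>p\<close>, the head
  of \<delta> with the tail of \<gamma> for \<open>q\<close>. On adding the two bounds the heads
  cancel, each with its own weights, so only weights after the meeting index have to be
  compared.\<close>

lemma exchange:
  assumes "geodesic \<omega> a q \<gamma>" and "geodesic \<omega>' a p \<delta>"
    and i: "i < length \<gamma>" "i < length \<delta>" "\<gamma> ! i = \<delta> ! i"
    and \<gamma>_le: "\<And>k. i < k \<Longrightarrow> k < length \<gamma> \<Longrightarrow> case_prod \<omega> (\<gamma> ! k) \<le> case_prod \<omega>' (\<gamma> ! k)"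
    and \<delta>_le: "\<And>k. i < k \<Longrightarrow> k < length \<delta> \<Longrightarrow> case_prod \<omega>' (\<delta> ! k) \<le> case_prod \<omega> (\<delta> ! k)"
  shows "last_passage \<omega> a q + last_passage \<omega>' a p \<le> last_passage \<omega>' a q + last_passage \<omega> a p"
proof -
  have \<gamma>: "\<gamma> \<in> paths a q" "path_weight \<omega> a \<gamma> = last_passage \<omega> a q"
    and \<delta>: "\<delta> \<in> paths a p" "path_weight \<omega>' a \<delta> = last_passage \<omega>' a p"
    using assms(1,2) by (auto simp: geodesic_def)
  let ?head = "\<lambda>\<omega> \<gamma>. \<Sum>k = 1..<Suc i. case_prod \<omega> (\<gamma> ! k)"
  let ?tail = "\<lambda>\<omega> \<gamma>. \<Sum>k = Suc i..<length \<gamma>. case_prod \<omega> (\<gamma> ! k)"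
  \<comment> \<open>Splicing a path with itself returns it, so the splice formula also cuts a single
    geodesic at \<open>i\<close>.\<close>
  have "last_passage \<omega> a q = ?head \<omega> \<gamma> + ?tail \<omega> \<gamma>"
    using path_weight_splice[OF \<gamma>(1) \<gamma>(1), of i \<omega>] i \<gamma>(2) by simp
  moreover have "last_passage \<omega>' a p = ?head \<omega>' \<delta> + ?tail \<omega>' \<delta>"
    using path_weight_splice[OF \<delta>(1) \<delta>(1), of i \<omega>'] i \<delta>(2) by simp
  moreover have "?head \<omega> \<gamma> + ?tail \<omega> \<delta> \<le> last_passage \<omega> a p"
    using path_weight_splice[OF \<gamma>(1) \<delta>(1) i, of \<omega>]
      path_weight_le_last_passage[OF path_splice[OF \<gamma>(1) \<delta>(1) i], of \<omega>] by linarith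
  moreover have "?head \<omega>' \<delta> + ?tail \<omega>' \<gamma> \<le> last_passage \<omega>' a q"
    using path_weight_splice[OF \<delta>(1) \<gamma>(1) i(2,1) i(3)[symmetric], of \<omega>']
      path_weight_le_last_passage[OF path_splice[OF \<delta>(1) \<gamma>(1) i(2,1) i(3)[symmetric]], of \<omega>']
    by linarith
  moreover have "?tail \<omega> \<gamma> \<le> ?tail \<omega>' \<gamma>"
    using \<gamma>_le by (intro sum_mono) auto
  moreover have "?tail \<omega>' \<delta> \<le> ?tail \<omega> \<delta>"
    using \<delta>_le by (intro sum_mono) auto
  ultimately show ?thesis by linarith
qed

text \<open>A discrete intermediate value argument: the difference of first coordinates changes by
  at most one per step, and where it vanishes the points agree, being on the same level.\<close>

lemma paths_cross:
  assumes \<gamma>: "\<gamma> \<in> paths a q" and \<delta>: "\<delta> \<in> paths a p" and "p \<preceq> q"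
    and t: "t < length \<gamma>" "t < length \<delta>" and le: "fst (\<gamma> ! t) \<le> fst (\<delta> ! t)"
  obtains i where "t \<le> i" "i < length \<gamma>" "i < length \<delta>" "\<gamma> ! i = \<delta> ! i"
proof -
  \<comment> \<open>The last index at which both paths are still running; one of them is at its
    end-point there.\<close>
  define n where "n = min (length \<gamma>) (length \<delta>) - 1"
  have n: "t \<le> n" "n < length \<gamma>" "n < length \<delta>" using t by (auto simp: n_def)
  let ?f = "\<lambda>i. fst (\<gamma> ! i) - fst (\<delta> ! i)"
  have steps: "\<forall>i. t \<le> i \<and> i < n \<longrightarrow> \<bar>?f (Suc i) - ?f i\<bar> \<le> 1"
  proof (intro allI impI)
    fix i assume "t \<le> i \<and> i < n"
    then show "\<bar>?f (Suc i) - ?f i\<bar> \<le> 1"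
      using path_step[OF \<gamma>, of i] path_step[OF \<delta>, of i] n
      by (auto simp: up_right_step_def)
  qed
  have "0 \<le> ?f n"
  proof (cases "length \<gamma> \<le> length \<delta>")
    case True
    then have "\<gamma> ! n = q" using path_last[OF \<gamma>] by (simp add: n_def)
    then show ?thesis
      using path_le_last[OF \<delta> n(3)] \<open>p \<preceq> q\<close> by (simp add: southeast_def)
  next
    \<comment> \<open>Here \<delta> stops first. The second coordinate of \<gamma> is at most
      \<open>snd q\<close>, hence at most \<open>snd p\<close>; on a common level this bounds its
      first coordinate below by \<open>fst p\<close>.\<close>
    case False
    then have "\<delta> ! n = p" using path_last[OF \<delta>] by (simp add: n_def)
    then show ?thesis
      using path_le_last[OF \<gamma> n(2)] path_level[OF \<gamma> n(2)] path_level[OF \<delta> n(3)] \<open>p \<preceq> q\<close>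
      by (simp add: southeast_def)
  qed
  then obtain i where i: "t \<le> i" "i \<le> n" "?f i = 0"
    using nat_intermed_int_val[OF steps n(1), of 0] le by auto
  then have "\<gamma> ! i = \<delta> ! i"
    using path_level[OF \<gamma>, of i] path_level[OF \<delta>, of i] n by (simp add: prod_eq_iff)
  then show thesis using that[of i] i n by simp
qed

text \<open>The second coordinate never decreases, so it stays positive. After a bulk vertex a path
  thus avoids the horizontal axis, where the two weights are not compared.\<close>

lemma path_after_bulk:
  assumes \<gamma>: "\<gamma> \<in> paths a b" and "\<gamma> ! i \<in> bulk" and "i \<le> k" and "k < length \<gamma>"
  shows "\<gamma> ! k \<in> bulk \<or> \<gamma> ! k \<in> diagonal"
  using path_mono[OF \<gamma> assms(3,4)] path_nth_half_space[OF \<gamma> assms(4)] assms(2)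
  by (auto simp: bulk_def diagonal_def half_space_def case_prod_unfold)

text \<open>Among half-space points of a given level, a diagonal point has the smallest first
  coordinate.\<close>

lemma diagonal_northwest:
  assumes \<gamma>: "\<gamma> \<in> paths a b" and \<delta>: "\<delta> \<in> paths a c"
    and "k < length \<gamma>" and "k < length \<delta>" and "\<gamma> ! k \<in> diagonal"
  shows "fst (\<gamma> ! k) \<le> fst (\<delta> ! k)"
  using path_level[OF \<gamma> assms(3)] path_level[OF \<delta> assms(4)] path_nth_half_space[OF \<delta> assms(4)]
    assms(5)
  by (auto simp: diagonal_def half_space_def case_prod_unfold)

theorem proposition3p1:
  fixes \<omega> \<omega>' :: "int \<Rightarrow> int \<Rightarrow> real"
    and \<pi> \<pi>' :: "point \<Rightarrow> point list"
    and p q :: point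
  assumes "\<forall>(i, j)\<in>bulk. \<omega>' i j = \<omega> i j"
    and "geodesics_from_origin \<omega> \<pi>"
    and "geodesics_from_origin \<omega>' \<pi>'"
    and "p \<in> bulk" and "q \<in> bulk" and "p \<preceq> q"
    and "set (\<pi>' p) \<inter> set (\<pi> q) \<inter> bulk \<noteq> {}"
    and "(\<forall>i\<ge>1. \<omega>' i i \<le> \<omega> i i) \<or>
         ((\<forall>i\<ge>1. \<omega>' i i \<ge> \<omega> i i) \<and> set (\<pi>' p) \<inter> diagonal = {})"
  shows "last_passage_origin \<omega> q - last_passage_origin \<omega> p
           \<le> last_passage_origin \<omega>' q - last_passage_origin \<omega>' p"
proof -
  have \<gamma>: "geodesic \<omega> (0, 0) q (\<pi> q)" and \<delta>: "geodesic \<omega>' (0, 0) p (\<pi>' p)"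
    using assms(2-5) by (auto simp: geodesics_from_origin_def bulk_def half_space_def)
  then have \<gamma>_path: "\<pi> q \<in> paths (0, 0) q" and \<delta>_path: "\<pi>' p \<in> paths (0, 0) p"
    by (auto simp: geodesic_def)
  obtain z where "z \<in> set (\<pi> q)" "z \<in> set (\<pi>' p)" and z: "z \<in> bulk"
    using assms(7) by blast
  then obtain s s' where s: "s < length (\<pi> q)" "\<pi> q ! s = z"
    and s': "s' < length (\<pi>' p)" "\<pi>' p ! s' = z"
    by (auto simp: in_set_conv_nth)
  have "s' = s"
    using path_level[OF \<gamma>_path s(1)] path_level[OF \<delta>_path s'(1)] s(2) s'(2) by simp
  have \<gamma>_after: "\<pi> q ! k \<in> bulk \<or> \<pi> q ! k \<in> diagonal" if "s \<le> k" "k < length (\<pi> q)" for k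
    using path_after_bulk[OF \<gamma>_path _ that] s z by simp
  have \<delta>_after: "\<pi>' p ! k \<in> bulk \<or> \<pi>' p ! k \<in> diagonal" if "s \<le> k" "k < length (\<pi>' p)" for k
    using path_after_bulk[OF \<delta>_path _ that] s' \<open>s' = s\<close> z by simp
  have bulk_eq: "case_prod \<omega>' v = case_prod \<omega> v" if "v \<in> bulk" for v
    using assms(1) that by auto
  \<comment> \<open>These are the hypotheses of \<open>exchange\<close>; the witness is the last
    common index under (a) and \<open>s\<close> under (b).\<close>
  have "\<exists>i. i < length (\<pi> q) \<and> i < length (\<pi>' p) \<and> \<pi> q ! i = \<pi>' p ! i \<and>
      (\<forall>k. i < k \<and> k < length (\<pi> q) \<longrightarrow> case_prod \<omega> (\<pi> q ! k) \<le> case_prod \<omega>' (\<pi> q ! k)) \<and>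
      (\<forall>k. i < k \<and> k < length (\<pi>' p) \<longrightarrow> case_prod \<omega>' (\<pi>' p ! k) \<le> case_prod \<omega> (\<pi>' p ! k))"
    (is "\<exists>i. ?good i")
    using assms(8)
  proof (elim disjE conjE)
    assume "\<forall>i\<ge>1. \<omega>' i i \<le> \<omega> i i"
    then have diag: "case_prod \<omega>' v \<le> case_prod \<omega> v" if "v \<in> diagonal" for v
      using that by (auto simp: diagonal_def)
    let ?common = "\<lambda>i. i < length (\<pi> q) \<and> i < length (\<pi>' p) \<and> \<pi> q ! i = \<pi>' p ! i"
    define i where "i = (GREATEST i. ?common i)"
    have bound: "\<And>j. ?common j \<Longrightarrow> j \<le> length (\<pi> q)" by simp
    have "?common s" using s s' \<open>s' = s\<close> by simp
    then have i: "?common i" and "s \<le> i"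
      unfolding i_def using GreatestI_nat[of ?common] Greatest_le_nat[of ?common] bound
      by blast+
    have i_max: "j \<le> i" if "?common j" for j
      unfolding i_def using that Greatest_le_nat[of ?common] bound by blast
    have bulk: "\<pi> q ! k \<in> bulk" if k: "i < k" "k < length (\<pi> q)" for k
    proof (rule ccontr)
      assume "\<pi> q ! k \<notin> bulk"
      then have kd: "\<pi> q ! k \<in> diagonal" using \<gamma>_after[of k] k \<open>s \<le> i\<close> by simp
      \<comment> \<open>\<open>\<pi>'(p)\<close> does not stop before level \<open>k\<close>: the endpoint \<open>p\<close> lies strictly above the level of
         \<open>\<pi>(q)\<^sub>k = (m, m)\<close>, because \<open>m \<le> snd q \<le> snd p < fst p\<close>.\<close>
      have "k < length (\<pi>' p)"
        using path_length[OF \<delta>_path] path_level[OF \<gamma>_path k(2)] path_le_last[OF \<gamma>_path k(2)]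
          kd assms(4,6)
        by (auto simp: diagonal_def bulk_def southeast_def case_prod_unfold)
      then obtain j where "k \<le> j" "?common j"
        using paths_cross[OF \<gamma>_path \<delta>_path assms(6) k(2)]
          diagonal_northwest[OF \<gamma>_path \<delta>_path k(2) _ kd] by metis
      then show False using i_max[of j] k by simp
    qed
    \<comment> \<open>The path to \<open>p\<close> may touch the diagonal: there (a) gives the
      inequality in the required direction.\<close>
    have "case_prod \<omega>' (\<pi>' p ! k) \<le> case_prod \<omega> (\<pi>' p ! k)" if "i < k" "k < length (\<pi>' p)" for k
      using \<delta>_after[of k] that \<open>s \<le> i\<close> bulk_eq[of "\<pi>' p ! k"] diag[of "\<pi>' p ! k"] by linarith
    moreover have "case_prod \<omega> (\<pi> q ! k) \<le> case_prod \<omega>' (\<pi> q ! k)" if "i < k" "k < length (\<pi> q)" for k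
      using bulk_eq[OF bulk[OF that]] by simp
    ultimately show ?thesis using i by blast
  next
    assume "\<forall>i\<ge>1. \<omega> i i \<le> \<omega>' i i" and disj: "set (\<pi>' p) \<inter> diagonal = {}"
    then have diag: "case_prod \<omega> v \<le> case_prod \<omega>' v" if "v \<in> diagonal" for v
      using that by (auto simp: diagonal_def)
    have "case_prod \<omega>' (\<pi>' p ! k) \<le> case_prod \<omega> (\<pi>' p ! k)" if k: "s < k" "k < length (\<pi>' p)" for k
    proof -
      have "\<pi>' p ! k \<notin> diagonal" using disj nth_mem[OF k(2)] by blast
      then show ?thesis using \<delta>_after[of k] k bulk_eq[of "\<pi>' p ! k"] by simp
    qed
    \<comment> \<open>Now the path to \<open>q\<close> may touch the diagonal, since the diagonal
      inequality is reversed.\<close>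
    moreover have "case_prod \<omega> (\<pi> q ! k) \<le> case_prod \<omega>' (\<pi> q ! k)" if "s < k" "k < length (\<pi> q)" for k
      using \<gamma>_after[of k] that bulk_eq[of "\<pi> q ! k"] diag[of "\<pi> q ! k"] by linarith
    moreover have "\<pi> q ! s = \<pi>' p ! s" using s(2) s'(2) \<open>s' = s\<close> by simp
    ultimately show ?thesis using s(1) s'(1) \<open>s' = s\<close> by blast
  qed
  then have "last_passage_origin \<omega> q + last_passage_origin \<omega>' p
      \<le> last_passage_origin \<omega>' q + last_passage_origin \<omega> p"
    using exchange[OF \<gamma> \<delta>] by blast
  then show ?thesis by linarith
qed

end
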